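(* Let $G(q) = b_0(q) + K_{n=1}^{\infty} \frac{a_n(q)}{b_n(q)}$ be a continued fraction with $a_n(q) \in \mathbb{Z}[q]$ for $n \geq 1$ and $b_n(q) \in \mathbb{Z}[q]$ for $n \geq 0$, with $n$-th approximant $P_n(q)/Q_n(q)$, and let $\chi_n(q) := \prod_{i=1}^{n} a_i(q)$. Suppose there exist constants $C_1, C_2 > 0$, positive integers $j$ and $d$, and, for each positive integer $m \equiv j \pmod d$, a positive integer $n(m)$, with $n(m) \to \infty$ as $m \to \infty$, such that for every $m \equiv j \pmod d$ and every primitive $m$-th root of unity $x_m$, $$|\chi_{n(m)}(x_m)| \geq C_1$$ and $$\max\{\, |Q_{n(m)}(x_m)|,\ |Q_{n(m)-1}(x_m)| \,\} \leq C_2 .$$ Then there is an uncountable set $Y_G$ of points on the unit circle $\{z \in \mathbb{C} : |z| = 1\}$ such that if $y \in Y_G$ then $G(y)$ does not converge to a finite value.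
   Context: Notation: $b_0 + K_{n=1}^{\infty} \frac{a_n}{b_n}$ denotes the continued fraction $b_0 + \cfrac{a_1}{b_1 + \cfrac{a_2}{b_2 + \cdots}}$. Its numerators $P_n$ and denominators $Q_n$ are the polynomials given by $P_{-1} = 1$, $P_0 = b_0$, $Q_{-1} = 0$, $Q_0 = 1$, and $P_n = b_n P_{n-1} + a_n P_{n-2}$, $Q_n = b_n Q_{n-1} + a_n Q_{n-2}$ for $n \geq 1$; the $n$-th approximant is $P_n/Q_n$. $G(y)$ converges to a finite value if there is $L \in \mathbb{C}$ with $\lim_{n\to\infty} P_n(y)/Q_n(y) = L$ (in particular $Q_n(y) \neq 0$ for all sufficiently large $n$). *)

theory Defs
  imports
    "HOL-Analysis.Analysis"
    "HOL-Computational_Algebra.Polynomial"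
    "HOL-Number_Theory.Cong"
begin

text \<open>
  The continued fraction \<open>b 0 + K (a n / b n)\<close> is given by its coefficient sequences. The value
  \<open>a 0\<close> is never used. The sequences below start at index \<open>0\<close>; the usual initial values at index
  \<open>-1\<close> (\<open>1\<close> for numerators, \<open>0\<close> for denominators) appear in the equations for index \<open>1\<close>.
\<close>

fun cf_num :: "(nat \<Rightarrow> 'a) \<Rightarrow> (nat \<Rightarrow> 'a) \<Rightarrow> nat \<Rightarrow> 'a :: comm_ring_1" where
  "cf_num a b 0 = b 0"
| "cf_num a b (Suc 0) = b 1 * b 0 + a 1 * 1"
| "cf_num a b (Suc (Suc n)) =
     b (Suc (Suc n)) * cf_num a b (Suc n) + a (Suc (Suc n)) * cf_num a b n"

fun cf_denom :: "(nat \<Rightarrow> 'a) \<Rightarrow> (nat \<Rightarrow> 'a) \<Rightarrow> nat \<Rightarrow> 'a :: comm_ring_1" where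
  "cf_denom a b 0 = 1"
| "cf_denom a b (Suc 0) = b 1 * 1 + a 1 * 0"
| "cf_denom a b (Suc (Suc n)) =
     b (Suc (Suc n)) * cf_denom a b (Suc n) + a (Suc (Suc n)) * cf_denom a b n"

definition cf_chi :: "(nat \<Rightarrow> 'a) \<Rightarrow> nat \<Rightarrow> 'a :: comm_ring_1" where
  "cf_chi a n = (\<Prod>i=1..n. a i)"

definition eval_int_poly :: "int poly \<Rightarrow> complex \<Rightarrow> complex" where
  "eval_int_poly p z = poly (map_poly of_int p) z"

text \<open>
  The condition that the denominators are eventually nonzero is stated explicitly, since
  \<open>x / 0 = 0\<close> in HOL.
\<close>

definition cf_converges_at :: "(nat \<Rightarrow> int poly) \<Rightarrow> (nat \<Rightarrow> int poly) \<Rightarrow> complex \<Rightarrow> bool" where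
  "cf_converges_at a b y \<longleftrightarrow>
     (\<forall>\<^sub>F n in sequentially. eval_int_poly (cf_denom a b n) y \<noteq> 0) \<and>
     (\<exists>L. (\<lambda>n. eval_int_poly (cf_num a b n) y / eval_int_poly (cf_denom a b n) y) \<longlonglongrightarrow> L)"

definition primitive_root_of_unity :: "nat \<Rightarrow> complex \<Rightarrow> bool" where
  "primitive_root_of_unity m x \<longleftrightarrow> m > 0 \<and> x ^ m = 1 \<and> (\<forall>k. 0 < k \<and> k < m \<longrightarrow> x ^ k \<noteq> 1)"

end

theory Submission
  imports
    Defs
    "HOL-Library.Real_Mod"
    "HOL-Computational_Algebra.Primes"
begin

text \<open>
  By the determinant formula, consecutive approximants at \<open>y\<close> differ by
  \<open>\<bar>\<chi>\<^sub>n(y)\<bar> / \<bar>Q\<^sub>n(y) Q\<^sub>n\<^sub>-\<^sub>1(y)\<bar>\<close>, so a lower bound on the numerator together with an upper bound on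
  the two denominators, for infinitely many \<open>n\<close>, excludes convergence. The hypotheses give such
  bounds at primitive \<open>m\<close>-th roots of unity and hence, by continuity and with slightly weaker
  constants, on neighbourhoods of them. Primitive \<open>m\<close>-th roots of unity with \<open>m \<equiv> j (mod d)\<close> and
  \<open>m \<ge> N\<close> are dense in the circle for every \<open>N\<close>. So the points lying in such neighbourhoods for
  infinitely many \<open>m\<close> form a countable intersection of dense open sets, which is
  uncountable by Baire's theorem.
\<close>

text \<open>Expanding one step of the recurrence cancels the terms in \<open>b\<close>, and the
  determinant is multiplied by minus the new partial numerator.\<close>

lemma cf_determinant:
  "cf_num a b (Suc k) * cf_denom a b k - cf_num a b k * cf_denom a b (Suc k)
    = (- 1) ^ k * cf_chi a (Suc k)"
proof (induction k)
  case 0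
  then show ?case by (simp add: cf_chi_def algebra_simps)
next
  case (Suc k)
  have "cf_num a b (Suc (Suc k)) * cf_denom a b (Suc k)
        - cf_num a b (Suc k) * cf_denom a b (Suc (Suc k))
      = - a (Suc (Suc k)) *
        (cf_num a b (Suc k) * cf_denom a b k - cf_num a b k * cf_denom a b (Suc k))"
    by (simp add: algebra_simps)
  also have "\<dots> = (- 1) ^ Suc k * cf_chi a (Suc (Suc k))"
    unfolding Suc.IH by (simp add: cf_chi_def mult_ac)
  finally show ?case .
qed

text \<open>Evaluation at a fixed point is a ring homomorphism; this carries the determinant formula
  from integer polynomials to complex values.\<close>

lemma eval_int_poly_0 [simp]: "eval_int_poly 0 z = 0"
  by (simp add: eval_int_poly_def)

lemma eval_int_poly_1 [simp]: "eval_int_poly 1 z = 1"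
  by (simp add: eval_int_poly_def)

lemma eval_int_poly_pCons [simp]:
  "eval_int_poly (pCons c p) z = of_int c + z * eval_int_poly p z"
  by (simp add: eval_int_poly_def map_poly_pCons)

lemma eval_int_poly_add [simp]:
  "eval_int_poly (p + q) z = eval_int_poly p z + eval_int_poly q z"
  by (induction p q rule: poly_induct2) (simp_all add: algebra_simps)

lemma eval_int_poly_smult [simp]:
  "eval_int_poly (smult c p) z = of_int c * eval_int_poly p z"
  by (induction p) (simp_all add: algebra_simps)

lemma eval_int_poly_mult [simp]:
  "eval_int_poly (p * q) z = eval_int_poly p z * eval_int_poly q z"
  by (induction p) (simp_all add: algebra_simps)

lemma eval_int_poly_minus [simp]: "eval_int_poly (- p) z = - eval_int_poly p z"
  using eval_int_poly_smult[of "- 1" p z] by simp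

lemma eval_int_poly_diff [simp]:
  "eval_int_poly (p - q) z = eval_int_poly p z - eval_int_poly q z"
  using eval_int_poly_add[of p "- q" z] by simp

lemma eval_int_poly_power [simp]: "eval_int_poly (p ^ k) z = eval_int_poly p z ^ k"
  by (induction k) simp_all

lemma continuous_on_eval_int_poly [continuous_intros]:
  "continuous_on A f \<Longrightarrow> continuous_on A (\<lambda>x. eval_int_poly p (f x))"
  unfolding eval_int_poly_def by (intro continuous_intros)

lemma not_cf_converges_atI:
  assumes "0 < c"
    and freq: "\<exists>\<^sub>F k in sequentially. c \<le> norm (eval_int_poly (cf_chi a (Suc k)) y) \<and>
      norm (eval_int_poly (cf_denom a b (Suc k)) y) \<le> B \<and>
      norm (eval_int_poly (cf_denom a b k) y) \<le> B"
  shows "\<not> cf_converges_at a b y"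
proof
  assume conv: "cf_converges_at a b y"
  define P where "P k = eval_int_poly (cf_num a b k) y" for k
  define Q where "Q k = eval_int_poly (cf_denom a b k) y" for k
  define X where "X k = eval_int_poly (cf_chi a k) y" for k
  from conv obtain L where nz: "\<forall>\<^sub>F k in sequentially. Q k \<noteq> 0"
    and lim: "(\<lambda>k. P k / Q k) \<longlonglongrightarrow> L"
    unfolding cf_converges_at_def P_def Q_def by blast
  have "\<exists>\<^sub>F k in sequentially. c \<le> norm (X (Suc k)) \<and> norm (Q (Suc k)) \<le> B \<and> norm (Q k) \<le> B"
    using freq by (simp add: X_def Q_def)
  moreover have "\<forall>\<^sub>F k in sequentially. Q (Suc k) \<noteq> 0"
    using nz by (subst eventually_sequentially_Suc)
  ultimately have freq': "\<exists>\<^sub>F k in sequentially.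
      (Q k \<noteq> 0 \<and> Q (Suc k) \<noteq> 0) \<and>
      c \<le> norm (X (Suc k)) \<and> norm (Q (Suc k)) \<le> B \<and> norm (Q k) \<le> B"
    using nz by (intro frequently_eventually_conj[OF _ eventually_conj])
  \<comment> \<open>Positivity of \<open>B\<close> is not assumed; it comes from a nonzero
    denominator of norm at most \<open>B\<close>.\<close>
  have "0 < B"
  proof -
    obtain k where "Q k \<noteq> 0" "norm (Q k) \<le> B"
      using frequently_ex[OF freq'] by blast
    then show ?thesis
      by (meson less_le_trans zero_less_norm_iff)
  qed
  \<comment> \<open>Convergence would push the differences of consecutive approximants below
    \<open>c / B\<^sup>2\<close>, the lower bound that the determinant formula gives for infinitely
    many \<open>k\<close>.\<close>
  have "(\<lambda>k. P (Suc k) / Q (Suc k) - P k / Q k) \<longlonglongrightarrow> L - L"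
    by (intro tendsto_diff lim LIMSEQ_Suc)
  then have "\<forall>\<^sub>F k in sequentially. norm (P (Suc k) / Q (Suc k) - P k / Q k) < c / B\<^sup>2"
    using \<open>0 < c\<close> \<open>0 < B\<close> by (auto simp: tendsto_iff dist_norm)
  with freq' obtain k where k: "Q k \<noteq> 0" "Q (Suc k) \<noteq> 0" "c \<le> norm (X (Suc k))"
      "norm (Q (Suc k)) \<le> B" "norm (Q k) \<le> B"
    and less: "norm (P (Suc k) / Q (Suc k) - P k / Q k) < c / B\<^sup>2"
    by (auto dest!: frequently_ex[OF frequently_eventually_conj])
  have "P (Suc k) * Q k - P k * Q (Suc k) = (- 1) ^ k * X (Suc k)"
    using arg_cong[OF cf_determinant[of a b k], of "\<lambda>p. eval_int_poly p y"]
    by (simp add: P_def Q_def X_def)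
  then have "P (Suc k) / Q (Suc k) - P k / Q k = (- 1) ^ k * X (Suc k) / (Q (Suc k) * Q k)"
    using k by (simp add: field_simps)
  then have "norm (P (Suc k) / Q (Suc k) - P k / Q k)
      = norm (X (Suc k)) / (norm (Q (Suc k)) * norm (Q k))"
    by (simp add: norm_mult norm_divide norm_power)
  also have "\<dots> \<ge> c / B\<^sup>2"
    unfolding power2_eq_square using k \<open>0 < c\<close> \<open>0 < B\<close>
    by (intro frac_le mult_mono mult_pos_pos) auto
  finally show False
    using less by simp
qed

text \<open>If the \<open>k\<close>-th power is 1, then \<open>k * p / m\<close> is an integer, so
  \<open>m\<close> divides \<open>k * p\<close> and by coprimality \<open>k\<close>.\<close>

lemma primitive_root_of_unity_cis:
  assumes "0 < m" "coprime p m"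
  shows "primitive_root_of_unity m (cis (2 * pi * (real p / real m)))"
proof -
  have "m dvd k" if "cis (2 * pi * (real p / real m)) ^ k = 1" for k
  proof -
    from that obtain i :: int where "real k * (2 * pi * (real p / real m)) = of_int i * (2 * pi)"
      unfolding Complex.DeMoivre cis_eq_1_iff by blast
    then have "real_of_int (int (k * p)) = real_of_int (i * int m)"
      using \<open>0 < m\<close> by (simp add: field_simps)
    then have "int (k * p) = i * int m"
      by (simp only: of_int_eq_iff)
    then have "m dvd k * p"
      by (metis dvd_triv_right int_dvd_int_iff)
    then show ?thesis
      using \<open>coprime p m\<close> by (simp add: coprime_commute coprime_dvd_mult_left_iff)
  qed
  then have "cis (2 * pi * (real p / real m)) ^ k \<noteq> 1" if "0 < k" "k < m" for k
    using that nat_dvd_not_less by blast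
  moreover have "cis (2 * pi * (real p / real m)) ^ m = 1"
    using \<open>0 < m\<close> by (simp add: Complex.DeMoivre)
  ultimately show ?thesis
    using \<open>0 < m\<close> by (simp add: primitive_root_of_unity_def)
qed

text \<open>
  The numerator is a prime \<open>p\<close>. Since \<open>x > 1\<close>, a denominator close to \<open>p / x\<close> is smaller than \<open>p\<close>,
  and therefore coprime to it.
\<close>

lemma coprime_fraction_approx:
  fixes x e :: real and j d N :: nat
  assumes "1 < x" "0 < e" "0 < d"
  obtains p m where "N \<le> m" "0 < m" "[m = j] (mod d)" "coprime p m" "\<bar>real p / real m - x\<bar> < e"
proof -
  obtain K :: nat where K: "x * real d / e < real K"
    using reals_Archimedean2 by blast
  \<comment> \<open>A lower bound for \<open>m\<close>: \<open>K\<close> controls the error,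
    \<open>N\<close> is the prescribed bound and 1 makes \<open>m\<close> positive. The summand
    \<open>j\<close> ensures that the truncated difference \<open>q - j\<close> below is
    exact.\<close>
  define M where "M = K + N + j + d + 1"
  obtain r :: nat where "x * real (M + d) < real r"
    using reals_Archimedean2 by blast
  moreover obtain p where p: "prime p" "r < p"
    using bigger_prime by blast
  ultimately have large: "x * real (M + d) < real p"
    by linarith
  define q where "q = nat \<lfloor>real p / x\<rfloor>"
  have q: "real q \<le> real p / x" "real p / x < real q + 1"
    using \<open>1 < x\<close> by (auto simp: q_def)
  have "real (M + d) < real p / x"
    using large \<open>1 < x\<close> by (simp add: field_simps)
  then have "M + d \<le> q"
    using q by linarith
  \<comment> \<open>The largest number up to \<open>q\<close> in the residue class of
    \<open>j\<close>, hence within \<open>d\<close> of \<open>p / x\<close>.\<close>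
  define m where "m = j + d * ((q - j) div d)"
  have "(q - j) mod d < d" "d * ((q - j) div d) + (q - j) mod d = q - j"
    using \<open>0 < d\<close> by simp_all
  then have m: "m \<le> q" "q < m + d"
    using \<open>M + d \<le> q\<close> unfolding m_def M_def by linarith+
  have "M \<le> m"
    using m \<open>M + d \<le> q\<close> by linarith
  then have "0 < m" "N \<le> m" "K \<le> m"
    by (auto simp: M_def)
  have "x * real m \<le> real p"
  proof -
    have "real m \<le> real p / x" using m q by linarith
    then show ?thesis using \<open>1 < x\<close> by (simp add: field_simps)
  qed
  moreover have "real m < x * real m"
    using \<open>0 < m\<close> \<open>1 < x\<close> by simp
  ultimately have "m < p"
    by linarith
  then have "coprime p m"
    using p(1) \<open>0 < m\<close> by (intro prime_imp_coprime) (auto dest: dvd_imp_le)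
  \<comment> \<open>Together with \<open>x * m \<le> p\<close> this puts \<open>p / m - x\<close>
    between 0 and \<open>x * d / m\<close>, which is below \<open>e\<close> by the choice of
    \<open>K\<close>.\<close>
  have "real p < x * (real m + real d)"
  proof -
    have "real p / x < real m + real d" using m q by linarith
    then show ?thesis using \<open>1 < x\<close> by (simp add: field_simps)
  qed
  moreover have "x * real d < e * real m"
  proof -
    have "x * real d / e < real m" using K \<open>K \<le> m\<close> by linarith
    then show ?thesis using \<open>0 < e\<close> by (simp add: field_simps)
  qed
  ultimately have "\<bar>real p / real m - x\<bar> < e"
    using \<open>x * real m \<le> real p\<close> \<open>0 < m\<close> by (simp add: abs_less_iff field_simps)
  moreover have "[m = j] (mod d)"
    by (simp add: m_def cong_def)
  ultimately show thesis
    using that \<open>N \<le> m\<close> \<open>0 < m\<close> \<open>coprime p m\<close> by blast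
qed

text \<open>The fraction approximation needs a target above 1. Shifting the angle by a natural
  number \<open>z\<close> achieves this without moving the point on the circle.\<close>

lemma primitive_roots_dense:
  fixes t e :: real and j d N :: nat
  assumes "0 < e" "0 < d"
  obtains s m where "\<bar>s - t\<bar> < e" "N \<le> m" "0 < m" "[m = j] (mod d)"
    "primitive_root_of_unity m (cis (2 * pi * s))"
proof -
  obtain z :: nat where "1 - t < real z"
    using reals_Archimedean2 by blast
  then have "1 < t + real z"
    by simp
  then obtain p m where m: "N \<le> m" "0 < m" "[m = j] (mod d)" "coprime p m"
    and pm: "\<bar>real p / real m - (t + real z)\<bar> < e"
    using coprime_fraction_approx assms by metis
  define s where "s = real p / real m - real z"
  have "2 * pi * (real p / real m) = 2 * pi * s + 2 * pi * real z"
    by (simp add: s_def algebra_simps)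
  then have "cis (2 * pi * (real p / real m)) = cis (2 * pi * s) * cis (2 * pi * real z)"
    by (simp only: cis_mult)
  then have "cis (2 * pi * (real p / real m)) = cis (2 * pi * s)"
    by (simp add: cis_multiple_2pi)
  then have "primitive_root_of_unity m (cis (2 * pi * s))"
    using primitive_root_of_unity_cis[OF m(2,4)] by simp
  moreover have "\<bar>s - t\<bar> < e"
    using pm by (simp add: s_def algebra_simps)
  ultimately show thesis
    using that m by blast
qed

text \<open>If the intersection were countable, adding the complements of its points to the family
  would leave a countable family of dense open sets with empty intersection, contradicting Baire's
  theorem.\<close>

lemma uncountable_INT_open_dense:
  fixes U :: "nat \<Rightarrow> real set"
  assumes "\<And>N. open (U N)" "\<And>N. closure (U N) = UNIV"
  shows "uncountable (\<Inter>N. U N)"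
proof
  assume "countable (\<Inter>N. U N)"
  define G where "G = range U \<union> (\<lambda>t. - {t}) ` (\<Inter>N. U N)"
  have "countable G"
    using \<open>countable (\<Inter>N. U N)\<close> by (simp add: G_def)
  moreover have "openin (top_of_set UNIV) T \<and> UNIV \<subseteq> closure T" if "T \<in> G" for T
    using that assms by (auto simp: G_def closure_complement)
  ultimately have "UNIV \<subseteq> closure (\<Inter>G)"
    by (intro Baire) auto
  moreover have "\<Inter>G = {}"
  proof (rule equals0I)
    fix t assume t: "t \<in> \<Inter>G"
    then have "t \<in> (\<Inter>N. U N)"
      unfolding G_def by simp
    then have "- {t} \<in> G"
      unfolding G_def by (intro UnI2 imageI)
    with t show False by (auto dest: InterD)
  qed
  ultimately show False
    by simp
qed

text \<open>Each fibre of the map lies in a translate of the integers, so a countable image would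
  make \<open>T\<close> a countable union of countable sets.\<close>

lemma uncountable_cis_image:
  assumes "uncountable T"
  shows "uncountable ((\<lambda>t. cis (2 * pi * t)) ` T)"
proof
  assume *: "countable ((\<lambda>t. cis (2 * pi * t)) ` T)"
  have "countable {t \<in> T. cis (2 * pi * t) = y}" for y
  proof (cases "\<exists>s. cis (2 * pi * s) = y")
    case True
    then obtain s where s: "cis (2 * pi * s) = y" by blast
    have "\<exists>i. t = s + real_of_int i" if "cis (2 * pi * t) = y" for t
    proof -
      have "cis (2 * pi * t - 2 * pi * s) = 1"
        using that s by (auto simp flip: cis_divide)
      then obtain i :: int where "2 * pi * t - 2 * pi * s = of_int i * (2 * pi)"
        by (auto simp: cis_eq_1_iff)
      then have "2 * pi * t = 2 * pi * (s + of_int i)"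
        by (simp add: algebra_simps)
      then show ?thesis by auto
    qed
    then have "{t \<in> T. cis (2 * pi * t) = y} \<subseteq> range (\<lambda>i::int. s + real_of_int i)"
      by auto
    then show ?thesis
      by (rule countable_subset) simp
  next
    case False
    then have empty: "{t \<in> T. cis (2 * pi * t) = y} = {}" by auto
    show ?thesis unfolding empty by simp
  qed
  then have "countable (\<Union>y\<in>(\<lambda>t. cis (2 * pi * t)) ` T. {t \<in> T. cis (2 * pi * t) = y})"
    using * by (intro countable_UN) auto
  moreover have "(\<Union>y\<in>(\<lambda>t. cis (2 * pi * t)) ` T. {t \<in> T. cis (2 * pi * t) = y}) = T"
    by auto
  ultimately show False
    using assms by simp
qed

theorem theorem3:
  fixes a b :: "nat \<Rightarrow> int poly"
    and C1 C2 :: real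
    and j d :: nat
    and n :: "nat \<Rightarrow> nat"
  assumes "C1 > 0" and "C2 > 0"
    and "j > 0" and "d > 0"
    and "\<And>m. m > 0 \<Longrightarrow> [m = j] (mod d) \<Longrightarrow> n m > 0"
    and "filterlim n at_top (inf at_top (principal {m. [m = j] (mod d)}))"
    and "\<And>m x. m > 0 \<Longrightarrow> [m = j] (mod d) \<Longrightarrow> primitive_root_of_unity m x \<Longrightarrow>
           norm (eval_int_poly (cf_chi a (n m)) x) \<ge> C1"
    and "\<And>m x. m > 0 \<Longrightarrow> [m = j] (mod d) \<Longrightarrow> primitive_root_of_unity m x \<Longrightarrow>
           max (norm (eval_int_poly (cf_denom a b (n m)) x))
               (norm (eval_int_poly (cf_denom a b (n m - 1)) x)) \<le> C2"
  shows "\<exists>Y :: complex set. uncountable Y \<and> Y \<subseteq> {z. norm z = 1} \<and>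
           (\<forall>y\<in>Y. \<not> cf_converges_at a b y)"
proof -
  \<comment> \<open>Angles are used instead of points of the circle, so that Baire's theorem is
    applied on the real line. The strict inequalities make the set open, and the slack in the
    constants lets it contain the angles of all primitive \<open>m\<close>-th roots of
    unity.\<close>
  define good where "good m = {t. C1 / 2 < norm (eval_int_poly (cf_chi a (n m)) (cis (2 * pi * t))) \<and>
    norm (eval_int_poly (cf_denom a b (n m)) (cis (2 * pi * t))) < C2 + 1 \<and>
    norm (eval_int_poly (cf_denom a b (n m - 1)) (cis (2 * pi * t))) < C2 + 1}" for m
  define U where "U N = (\<Union>m\<in>{m. N \<le> m \<and> 0 < m \<and> [m = j] (mod d)}. good m)" for N
  have "open (good m)" for m
    unfolding good_def
    by (intro open_Collect_conj open_Collect_less continuous_intros)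
  then have "open (U N)" for N
    by (auto simp: U_def)
  moreover have "closure (U N) = UNIV" for N
  proof -
    have "\<exists>s\<in>U N. dist s t < e" if "0 < e" for t e
    proof -
      obtain s m where s: "\<bar>s - t\<bar> < e"
        and m: "N \<le> m" "0 < m" "[m = j] (mod d)"
        and prim: "primitive_root_of_unity m (cis (2 * pi * s))"
        using primitive_roots_dense[OF \<open>0 < e\<close> \<open>d > 0\<close>] by metis
      have "s \<in> good m"
        using assms(7)[OF m(2,3) prim] assms(8)[OF m(2,3) prim] \<open>C1 > 0\<close>
        by (simp add: good_def)
      with m s show ?thesis
        by (auto simp: U_def dist_real_def)
    qed
    then show ?thesis
      by (auto simp: closure_approachable)
  qed
  ultimately have "uncountable (\<Inter>N. U N)"
    by (rule uncountable_INT_open_dense)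
  then have "uncountable ((\<lambda>t. cis (2 * pi * t)) ` (\<Inter>N. U N))"
    by (rule uncountable_cis_image)
  moreover have "\<not> cf_converges_at a b (cis (2 * pi * t))" if t: "t \<in> (\<Inter>N. U N)" for t
  proof (rule not_cf_converges_atI)
    show "0 < C1 / 2"
      using \<open>C1 > 0\<close> by simp
    show "\<exists>\<^sub>F k in sequentially.
        C1 / 2 \<le> norm (eval_int_poly (cf_chi a (Suc k)) (cis (2 * pi * t))) \<and>
        norm (eval_int_poly (cf_denom a b (Suc k)) (cis (2 * pi * t))) \<le> C2 + 1 \<and>
        norm (eval_int_poly (cf_denom a b k) (cis (2 * pi * t))) \<le> C2 + 1"
      unfolding frequently_sequentially
    proof
      fix K
      \<comment> \<open>Since \<open>n m\<close> tends to infinity along the residue class,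
        arbitrarily large \<open>m\<close> yield arbitrarily large indices
        \<open>n m\<close>.\<close>
      have "\<forall>\<^sub>F m in inf at_top (principal {m. [m = j] (mod d)}). Suc K \<le> n m"
        using assms(6) by (simp add: filterlim_at_top)
      then obtain N where N: "\<And>m. N \<le> m \<Longrightarrow> [m = j] (mod d) \<Longrightarrow> Suc K \<le> n m"
        by (auto simp: eventually_inf_principal eventually_sequentially)
      from t obtain m where "N \<le> m" "[m = j] (mod d)" "t \<in> good m"
        by (auto simp: U_def)
      then show "\<exists>k\<ge>K. C1 / 2 \<le> norm (eval_int_poly (cf_chi a (Suc k)) (cis (2 * pi * t))) \<and>
        norm (eval_int_poly (cf_denom a b (Suc k)) (cis (2 * pi * t))) \<le> C2 + 1 \<and>
        norm (eval_int_poly (cf_denom a b k) (cis (2 * pi * t))) \<le> C2 + 1"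
        \<comment> \<open>As \<open>Suc K \<le> n m\<close>, the truncated subtraction is harmless:
          \<open>Suc (n m - 1) = n m\<close> and \<open>n m - 1 \<ge> K\<close>.\<close>
        using N[of m] by (intro exI[of _ "n m - 1"]) (auto simp: good_def)
    qed
  qed
  ultimately show ?thesis
    by (intro exI[of _ "(\<lambda>t. cis (2 * pi * t)) ` (\<Inter>N. U N)"]) auto
qed

end
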